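(* Let $A=\mathrm{diag}(\lambda_1,\dots,\lambda_n)\in\mathbb{R}^{n\times n}$ with $\lambda_1<\lambda_2<\cdots<\lambda_n$, and let $v_0\in\mathbb{R}^n$ be a unit norm vector with $d(A,v_0)\geq 2$. Consider the iteration $$\widetilde v_{k+1}=(A-\rho_k I)v_k,\quad \rho_k=v_k^TAv_k,\qquad v_{k+1}=\widetilde v_{k+1}/\|\widetilde v_{k+1}\|,\qquad k=0,1,2,\dots.$$ Then the subsequence $\{v_{2k}\}$ converges (i.e. it has a single limit vector).
   Context: $d(A,v)$ denotes the grade of $v$ w.r.t. $A$, i.e. the degree of the monic polynomial $p$ of smallest degree with $p(A)v=0$; for diagonal $A$ with distinct diagonal entries this is the number of nonzero entries of $v$. $\|\cdot\|$ is the Euclidean norm. *)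

theory Defs
  imports "HOL-Analysis.Analysis"
begin

text \<open>Grade of v w.r.t. A: the degree of the monic polynomial p of least degree
  with p(A) v = 0, where p(A) v = A^d v + sum_{i<d} c_i A^i v.\<close>
definition grade :: "real^'n^'n \<Rightarrow> real^'n \<Rightarrow> nat" where
  "grade A v = (LEAST d. \<exists>c :: nat \<Rightarrow> real.
      (((*v) A ^^ d) v) + (\<Sum>i<d. c i *\<^sub>R (((*v) A ^^ i) v)) = 0)"

end

theory Submission
  imports Defs "HOL-Computational_Algebra.Polynomial"
begin

(* Let T be the step map and s(x) = ||(A - rho(x) I) x||^2 the squared residual. For a unit
   vector x, s(T x) - s(x) is 1/s(x) times a sum of squares weighted by the x_i^2, so s increases
   along the iteration and converges to some L > 0. At a limit point g of the even iterates
   s(g) = s(T g) = L, and equality in that sum of squares forces lam_i - rho(g) to be a root of a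
   fixed quadratic for every nonzero g_i; as the lam_i are distinct, g lives on a coordinate
   plane {i, j}. There T is a quarter turn up to sign, so T (T g) = g, and the unit vectors on
   coordinate planes with s = L form a finite set. Hence the even iterates form a bounded sequence
   whose steps tend to zero and which has only finitely many limit points, so it converges. *)

section \<open>Bounded sequences with vanishing steps\<close>

lemma bounded_frequently_convergent_subseq:
  fixes u :: "nat \<Rightarrow> 'a::heine_borel"
  assumes "bounded (range u)" and "\<exists>\<^sub>F n in sequentially. P n"
  obtains r l where "strict_mono r" "(u \<circ> r) \<longlonglongrightarrow> l" "\<forall>n. P (r n)"
proof -
  have "infinite {n. P n}"
    using assms(2) by (simp add: frequently_cofinite flip: cofinite_eq_sequentially)
  then obtain s :: "nat \<Rightarrow> nat" where s: "strict_mono s" "\<forall>n. P (s n)"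
    using infinite_enumerate by blast
  have "bounded (range (u \<circ> s))"
    using assms(1) by (rule bounded_subset) auto
  then obtain l r where "strict_mono r" "((u \<circ> s) \<circ> r) \<longlonglongrightarrow> l"
    using bounded_imp_convergent_subsequence by blast
  with s show thesis
    using that[of "s \<circ> r" l] strict_mono_o by (auto simp: o_assoc)
qed

lemma dist_Suc_tendsto_0_if_limit_points_fixed:
  fixes u :: "nat \<Rightarrow> 'a::heine_borel"
  assumes bounded: "bounded (range u)"
    and step: "\<And>n. u (Suc n) = F (u n)"
    and fixed: "\<And>r l. strict_mono r \<Longrightarrow> (u \<circ> r) \<longlonglongrightarrow> l \<Longrightarrow> F l = l \<and> isCont F l"
  shows "(\<lambda>n. dist (u (Suc n)) (u n)) \<longlonglongrightarrow> 0"
proof (rule tendstoI, rule ccontr)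
  fix e :: real
  assume "e > 0" and "\<not> (\<forall>\<^sub>F n in sequentially. dist (dist (u (Suc n)) (u n)) 0 < e)"
  then have "\<exists>\<^sub>F n in sequentially. e \<le> dist (u (Suc n)) (u n)"
    by (simp add: not_eventually not_less)
  then obtain r l where r: "strict_mono r" and lim: "(u \<circ> r) \<longlonglongrightarrow> l"
    and far: "\<forall>n. e \<le> dist (u (Suc (r n))) (u (r n))"
    using bounded_frequently_convergent_subseq[OF bounded] by blast
  have "(\<lambda>n. F (u (r n))) \<longlonglongrightarrow> F l"
    using fixed[OF r lim] isCont_tendsto_compose lim unfolding o_def by blast
  then have "(\<lambda>n. dist (u (Suc (r n))) (u (r n))) \<longlonglongrightarrow> dist (F l) l"
    using lim unfolding step o_def by (rule tendsto_dist)
  then have "(\<lambda>n. dist (u (Suc (r n))) (u (r n))) \<longlonglongrightarrow> dist l l"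
    using fixed[OF r lim] by simp
  then have "e \<le> dist l l"
    using far by (auto intro: LIMSEQ_le_const)
  with \<open>e > 0\<close> show False by simp
qed

lemma eventually_notin_closed_if_limit_points_outside:
  fixes u :: "nat \<Rightarrow> 'a::heine_borel"
  assumes bounded: "bounded (range u)" and "closed K"
    and limit_points: "\<And>r l. strict_mono r \<Longrightarrow> (u \<circ> r) \<longlonglongrightarrow> l \<Longrightarrow> l \<notin> K"
  shows "\<forall>\<^sub>F n in sequentially. u n \<notin> K"
proof (rule ccontr)
  assume "\<not> ?thesis"
  then obtain r l where "strict_mono r" "(u \<circ> r) \<longlonglongrightarrow> l" "\<forall>n. u (r n) \<in> K"
    using bounded_frequently_convergent_subseq[OF bounded] by (auto simp: not_eventually)
  with \<open>closed K\<close> limit_points show False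
    using closed_sequentially[of K "u \<circ> r" l] by auto
qed

lemma convergent_if_dist_Suc_tendsto_0_finite_limit_points:
  fixes u :: "nat \<Rightarrow> 'a::heine_borel"
  assumes bounded: "bounded (range u)"
    and steps: "(\<lambda>n. dist (u (Suc n)) (u n)) \<longlonglongrightarrow> 0"
    and "finite \<Lambda>"
    and limit_points: "\<And>r l. strict_mono r \<Longrightarrow> (u \<circ> r) \<longlonglongrightarrow> l \<Longrightarrow> l \<in> \<Lambda>"
  shows "convergent u"
proof -
  obtain f r where r: "strict_mono r" "(u \<circ> r) \<longlonglongrightarrow> f"
    using bounded_imp_convergent_subsequence[OF bounded] by blast
  obtain \<delta> where "\<delta> > 0" and isolated: "\<And>l. l \<in> \<Lambda> \<Longrightarrow> l \<noteq> f \<Longrightarrow> \<delta> \<le> dist f l"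
    using finite_set_avoid[OF \<open>finite \<Lambda>\<close>, of f] by blast
  have "u \<longlonglongrightarrow> f"
  proof (rule metric_LIMSEQ_I)
    fix \<epsilon> :: real
    assume "\<epsilon> > 0"
    define e where "e = min \<epsilon> (\<delta> / 2)"
    have "e > 0"
      using \<open>\<epsilon> > 0\<close> \<open>\<delta> > 0\<close> by (simp add: e_def)
    define K where "K = cball f e - ball f (e / 2)"
    have "closed K"
      by (auto simp: K_def)
    have "l \<notin> K" if "strict_mono s" "(u \<circ> s) \<longlonglongrightarrow> l" for s l
      using limit_points[OF that] isolated[of l] \<open>e > 0\<close> by (force simp: K_def e_def)
    then have "\<forall>\<^sub>F n in sequentially. u n \<notin> K"
      using eventually_notin_closed_if_limit_points_outside[OF bounded \<open>closed K\<close>] by blast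
    moreover have "\<forall>\<^sub>F n in sequentially. dist (u (Suc n)) (u n) < e / 2"
      using steps \<open>e > 0\<close> by (auto dest: tendstoD[where e = "e / 2"])
    ultimately have "\<forall>\<^sub>F n in sequentially. u n \<notin> K \<and> dist (u (Suc n)) (u n) < e / 2"
      by (rule eventually_conj)
    then obtain N where N: "\<And>n. n \<ge> N \<Longrightarrow> u n \<notin> K \<and> dist (u (Suc n)) (u n) < e / 2"
      unfolding eventually_sequentially by blast
    have "\<forall>\<^sub>F m in sequentially. dist (u (r m)) f < e / 2"
      using r(2) \<open>e > 0\<close> by (auto simp: o_def dest: tendstoD[where e = "e / 2"])
    then obtain m where m: "dist (u (r m)) f < e / 2" "m \<ge> N"
      unfolding eventually_sequentially by (metis nle_le)
    \<comment> \<open>steps shorter than e/2 cannot jump over the annulus K, which is eventually avoided\<close>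
    have trapped: "dist (u n) f < e / 2" if "n \<ge> r m" for n
      using that
    proof (induction n rule: dec_induct)
      case base
      show ?case using m(1) .
    next
      case (step n)
      have "n \<ge> N"
        using seq_suble[OF r(1), of m] m(2) step.hyps(1) by linarith
      have "dist (u (Suc n)) f \<le> dist (u (Suc n)) (u n) + dist (u n) f"
        by (rule dist_triangle)
      also have "\<dots> < e"
        using N[OF \<open>n \<ge> N\<close>] step.IH by linarith
      finally show ?case
        using N[of "Suc n"] \<open>n \<ge> N\<close> by (auto simp: K_def dist_commute)
    qed
    have "e \<le> \<epsilon>"
      by (simp add: e_def)
    show "\<exists>n0. \<forall>n\<ge>n0. dist (u n) f < \<epsilon>"
    proof (intro exI allI impI)
      fix n
      assume "n \<ge> r m"
      then show "dist (u n) f < \<epsilon>"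
        using trapped[of n] \<open>e \<le> \<epsilon>\<close> \<open>e > 0\<close> by linarith
    qed
  qed
  then show ?thesis
    by (auto simp: convergent_def)
qed

section \<open>The residual map of a diagonal matrix\<close>

(* For A = diag lam: rayleigh lam x = x^T A x, residual lam x = (A - rho I) x,
   residual_sq lam x = ||residual lam x||^2, and residual_step lam maps v_k to v_(k+1). *)
definition rayleigh :: "('n::finite \<Rightarrow> real) \<Rightarrow> real^'n \<Rightarrow> real" where
  "rayleigh lam x = (\<Sum>i\<in>UNIV. lam i * (x$i)^2)"

definition residual :: "('n::finite \<Rightarrow> real) \<Rightarrow> real^'n \<Rightarrow> real^'n" where
  "residual lam x = (\<chi> i. (lam i - rayleigh lam x) * x$i)"

definition residual_sq :: "('n::finite \<Rightarrow> real) \<Rightarrow> real^'n \<Rightarrow> real" where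
  "residual_sq lam x = (\<Sum>i\<in>UNIV. (lam i - rayleigh lam x)^2 * (x$i)^2)"

definition residual_step :: "('n::finite \<Rightarrow> real) \<Rightarrow> real^'n \<Rightarrow> real^'n" where
  "residual_step lam x = residual lam x /\<^sub>R norm (residual lam x)"

definition two_sparse :: "real^'n \<Rightarrow> bool" where
  "two_sparse x \<longleftrightarrow> (\<exists>i j. i \<noteq> j \<and> (\<forall>k. k \<noteq> i \<longrightarrow> k \<noteq> j \<longrightarrow> x$k = 0))"

lemma norm_sq_eq_sum_sq: "norm (x::real^'n::finite) ^ 2 = (\<Sum>i\<in>UNIV. (x$i)^2)"
  unfolding power2_norm_eq_inner inner_vec_def by (simp add: power2_eq_square)

lemma norm_eq_1_iff_sum_sq: "norm (x::real^'n::finite) = 1 \<longleftrightarrow> (\<Sum>i\<in>UNIV. (x$i)^2) = 1"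
  by (metis norm_sq_eq_sum_sq norm_ge_zero power_one real_sqrt_unique real_sqrt_one)

lemma norm_residual: "norm (residual lam x) = sqrt (residual_sq lam x)"
  by (simp add: norm_eq_sqrt_inner inner_vec_def residual_def residual_sq_def power2_eq_square
      mult_ac)

lemma residual_sq_nonneg: "residual_sq lam x \<ge> 0"
  unfolding residual_sq_def by (intro sum_nonneg) simp

lemma residual_step_nth:
  "residual_step lam x $ i = (lam i - rayleigh lam x) * x$i / sqrt (residual_sq lam x)"
  unfolding residual_step_def norm_residual by (simp add: residual_def divide_inverse mult.commute)

lemma norm_residual_step:
  assumes "residual_sq lam x > 0"
  shows "norm (residual_step lam x) = 1"
  using assms by (simp add: residual_step_def norm_residual)

lemma sum_centered_eq_zero:
  assumes "norm (x::real^'n::finite) = 1"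
  shows "(\<Sum>i\<in>UNIV. (lam i - rayleigh lam x) * (x$i)^2) = 0"
proof -
  have "(\<Sum>i\<in>UNIV. (lam i - rayleigh lam x) * (x$i)^2)
      = rayleigh lam x - rayleigh lam x * (\<Sum>i\<in>UNIV. (x$i)^2)"
    by (simp add: rayleigh_def left_diff_distrib sum_subtractf sum_distrib_left mult.assoc)
  then show ?thesis
    using assms by (simp add: norm_eq_1_iff_sum_sq)
qed

lemma sum_sq_deviation:
  assumes "norm (x::real^'n::finite) = 1"
  shows "(\<Sum>i\<in>UNIV. (lam i - c)^2 * (x$i)^2) = residual_sq lam x + (rayleigh lam x - c)^2"
proof -
  let ?r = "rayleigh lam x"
  have "(\<Sum>i\<in>UNIV. (lam i - c)^2 * (x$i)^2)
      = (\<Sum>i\<in>UNIV. (lam i - ?r)^2 * (x$i)^2 + 2 * (?r - c) * ((lam i - ?r) * (x$i)^2)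
          + (?r - c)^2 * (x$i)^2)"
    by (rule sum.cong) (auto simp: power2_eq_square algebra_simps)
  also have "\<dots> = residual_sq lam x + 2 * (?r - c) * (\<Sum>i\<in>UNIV. (lam i - ?r) * (x$i)^2)
      + (?r - c)^2 * (\<Sum>i\<in>UNIV. (x$i)^2)"
    by (simp add: sum.distrib sum_distrib_left residual_sq_def)
  finally show ?thesis
    using assms by (simp add: sum_centered_eq_zero norm_eq_1_iff_sum_sq)
qed

lemma residual_sq_residual_step:
  fixes x :: "real^'n::finite"
  assumes unit: "norm x = 1" and pos: "residual_sq lam x > 0"
  defines "d \<equiv> \<lambda>i. lam i - rayleigh lam x" and "s \<equiv> residual_sq lam x"
  shows "residual_sq lam (residual_step lam x)
    = (\<Sum>i\<in>UNIV. (x$i)^2 * d i ^ 4) / s - ((\<Sum>i\<in>UNIV. (x$i)^2 * d i ^ 3) / s)^2"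
proof -
  define y where "y = residual_step lam x"
  have y_sq: "(y$i)^2 = d i ^ 2 * (x$i)^2 / s" for i
    using pos by (simp add: y_def residual_step_nth d_def s_def power_mult_distrib power_divide)
  have "norm y = 1"
    using pos by (simp add: y_def norm_residual_step)
  then have "residual_sq lam y = (\<Sum>i\<in>UNIV. d i ^ 2 * (y$i)^2) - (rayleigh lam y - rayleigh lam x)^2"
    using sum_sq_deviation[of y lam "rayleigh lam x"] by (simp add: d_def)
  moreover have "(\<Sum>i\<in>UNIV. d i ^ 2 * (y$i)^2) = (\<Sum>i\<in>UNIV. (x$i)^2 * d i ^ 4) / s"
    unfolding y_sq by (simp add: sum_divide_distrib power2_eq_square power4_eq_xxxx mult_ac)
  moreover have "rayleigh lam y - rayleigh lam x = (\<Sum>i\<in>UNIV. (x$i)^2 * d i ^ 3) / s"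
  proof -
    have "(\<Sum>i\<in>UNIV. d i * (y$i)^2) = rayleigh lam y - rayleigh lam x * (\<Sum>i\<in>UNIV. (y$i)^2)"
      by (simp add: d_def rayleigh_def[of lam y] left_diff_distrib sum_subtractf sum_distrib_left
          mult.assoc)
    then have "rayleigh lam y - rayleigh lam x = (\<Sum>i\<in>UNIV. d i * (y$i)^2)"
      using \<open>norm y = 1\<close> by (simp add: norm_eq_1_iff_sum_sq)
    then show ?thesis
      unfolding y_sq by (simp add: sum_divide_distrib power2_eq_square power3_eq_cube mult_ac)
  qed
  ultimately show ?thesis
    by (simp add: y_def)
qed

lemma residual_sq_residual_step_diff:
  fixes x :: "real^'n::finite"
  assumes unit: "norm x = 1" and pos: "residual_sq lam x > 0"
  defines "d \<equiv> \<lambda>i. lam i - rayleigh lam x" and "s \<equiv> residual_sq lam x"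
  defines "t \<equiv> (\<Sum>i\<in>UNIV. (x$i)^2 * d i ^ 3) / s"
  shows "residual_sq lam (residual_step lam x) - s = (\<Sum>i\<in>UNIV. (x$i)^2 * (d i ^ 2 - t * d i - s)^2) / s"
proof -
  define m3 where "m3 = (\<Sum>i\<in>UNIV. (x$i)^2 * d i ^ 3)"
  define m4 where "m4 = (\<Sum>i\<in>UNIV. (x$i)^2 * d i ^ 4)"
  have m0: "(\<Sum>i\<in>UNIV. (x$i)^2) = 1"
    using unit by (simp add: norm_eq_1_iff_sum_sq)
  have m1: "(\<Sum>i\<in>UNIV. (x$i)^2 * d i) = 0"
    using sum_centered_eq_zero[OF unit, of lam] by (simp add: d_def mult.commute)
  have m2: "(\<Sum>i\<in>UNIV. (x$i)^2 * d i ^ 2) = s"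
    by (simp add: s_def residual_sq_def d_def mult.commute)
  have "(\<Sum>i\<in>UNIV. (x$i)^2 * (d i ^ 2 - t * d i - s)^2)
      = (\<Sum>i\<in>UNIV. (x$i)^2 * d i ^ 4 - (2 * t) * ((x$i)^2 * d i ^ 3)
          + (t^2 - 2 * s) * ((x$i)^2 * d i ^ 2) + (2 * t * s) * ((x$i)^2 * d i) + s^2 * (x$i)^2)"
    by (rule sum.cong) (auto simp: power2_eq_square power3_eq_cube power4_eq_xxxx algebra_simps)
  also have "\<dots> = m4 - 2 * t * m3 + (t^2 - 2 * s) * s + s^2"
    by (simp add: sum.distrib sum_subtractf m0 m1 m2 m3_def m4_def flip: sum_distrib_left)
  finally have "(\<Sum>i\<in>UNIV. (x$i)^2 * (d i ^ 2 - t * d i - s)^2) = m4 - 2 * t * m3 + (t^2 - 2 * s) * s + s^2" .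
  moreover have "residual_sq lam (residual_step lam x) = m4 / s - (m3 / s)^2"
    using residual_sq_residual_step[OF unit pos] by (simp add: m3_def m4_def d_def s_def)
  ultimately show ?thesis
    using pos by (simp add: t_def flip: m3_def s_def) (simp add: field_simps power2_eq_square)
qed

lemma residual_sq_le_residual_sq_step:
  assumes "norm x = 1" and "residual_sq lam x > 0"
  shows "residual_sq lam x \<le> residual_sq lam (residual_step lam x)"
proof -
  let ?d = "\<lambda>i. lam i - rayleigh lam x"
  let ?t = "(\<Sum>i\<in>UNIV. (x$i)^2 * ?d i ^ 3) / residual_sq lam x"
  have "(\<Sum>i\<in>UNIV. (x$i)^2 * (?d i ^ 2 - ?t * ?d i - residual_sq lam x)^2) / residual_sq lam x \<ge> 0"
    using assms(2) by (intro divide_nonneg_pos sum_nonneg) auto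
  then show ?thesis
    using residual_sq_residual_step_diff[OF assms] by simp
qed

lemma residual_sq_eq_0_if_single_support:
  assumes "norm (x::real^'n::finite) = 1" and "\<forall>k. k \<noteq> i \<longrightarrow> x$k = 0"
  shows "residual_sq lam x = 0"
proof -
  have "rayleigh lam x = (\<Sum>k\<in>UNIV. lam i * (x$k)^2)"
    unfolding rayleigh_def by (rule sum.cong) (use assms(2) in auto)
  then have "rayleigh lam x = lam i"
    using assms(1) by (simp add: norm_eq_1_iff_sum_sq flip: sum_distrib_left)
  then show ?thesis
    unfolding residual_sq_def using assms(2) by (intro sum.neutral) auto
qed

lemma two_sparse_if_residual_sq_step_eq:
  fixes x :: "real^'n::finite"
  assumes unit: "norm x = 1" and pos: "residual_sq lam x > 0" and "inj lam"
    and eq: "residual_sq lam (residual_step lam x) = residual_sq lam x"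
  shows "two_sparse x"
proof -
  define d where "d = (\<lambda>i. lam i - rayleigh lam x)"
  define t where "t = (\<Sum>i\<in>UNIV. (x$i)^2 * d i ^ 3) / residual_sq lam x"
  have "(\<Sum>i\<in>UNIV. (x$i)^2 * (d i ^ 2 - t * d i - residual_sq lam x)^2) = 0"
    using residual_sq_residual_step_diff[OF unit pos] eq pos by (simp add: d_def t_def)
  then have "\<forall>i\<in>UNIV. (x$i)^2 * (d i ^ 2 - t * d i - residual_sq lam x)^2 = 0"
    by (subst sum_nonneg_eq_0_iff[symmetric]) auto
  then have root: "d i ^ 2 - t * d i - residual_sq lam x = 0" if "x$i \<noteq> 0" for i
    using that by auto
  have "inj d"
    using \<open>inj lam\<close> by (simp add: d_def inj_def)
  have sum_roots: "d i + d j = t" if "x$i \<noteq> 0" "x$j \<noteq> 0" "i \<noteq> j" for i j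
  proof -
    have "(d i - d j) * (d i + d j - t) = 0"
      using root[OF that(1)] root[OF that(2)] by (simp add: algebra_simps power2_eq_square)
    moreover have "d i \<noteq> d j"
      using \<open>inj d\<close> that(3) by (auto dest: injD)
    ultimately show ?thesis by simp
  qed
  obtain i where i: "x$i \<noteq> 0"
    using unit by (metis norm_zero vec_eq_iff zero_neq_one zero_index)
  obtain j where j: "j \<noteq> i" "x$j \<noteq> 0"
    using residual_sq_eq_0_if_single_support[OF unit, of i lam] pos by auto
  have "x$k = 0" if "k \<noteq> i" "k \<noteq> j" for k
  proof (rule ccontr)
    assume "x$k \<noteq> 0"
    then have "d k = d j"
      using sum_roots[OF i] j that by (metis add_left_cancel)
    with \<open>inj d\<close> that(2) show False by (auto dest: injD)
  qed
  then show ?thesis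
    unfolding two_sparse_def using j(1) by blast
qed

lemma sum_UNIV_two_support:
  fixes f :: "'n::finite \<Rightarrow> 'a::comm_monoid_add"
  assumes "i \<noteq> j" and "\<forall>k. k \<noteq> i \<longrightarrow> k \<noteq> j \<longrightarrow> f k = 0"
  shows "sum f UNIV = f i + f j"
proof -
  have "sum f UNIV = sum f {i, j}"
    by (rule sum.mono_neutral_right) (use assms in auto)
  then show ?thesis
    using assms(1) by simp
qed

lemma two_support_unit:
  fixes x :: "real^'n::finite"
  assumes "norm x = 1" and "i \<noteq> j" and supp: "\<forall>k. k \<noteq> i \<longrightarrow> k \<noteq> j \<longrightarrow> x$k = 0"
  shows "(x$i)^2 + (x$j)^2 = 1"
    and "rayleigh lam x = (x$i)^2 * lam i + (x$j)^2 * lam j"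
    and "residual_sq lam x = (x$i * x$j * (lam j - lam i))^2"
proof -
  show sum_sq: "(x$i)^2 + (x$j)^2 = 1"
    using assms sum_UNIV_two_support[OF \<open>i \<noteq> j\<close>, of "\<lambda>k. (x$k)^2"]
    by (simp add: norm_eq_1_iff_sum_sq)
  show rayleigh: "rayleigh lam x = (x$i)^2 * lam i + (x$j)^2 * lam j"
    unfolding rayleigh_def using supp sum_UNIV_two_support[OF \<open>i \<noteq> j\<close>, of "\<lambda>k. lam k * (x$k)^2"]
    by (simp add: mult.commute)
  have "residual_sq lam x = (lam i - rayleigh lam x)^2 * (x$i)^2 + (lam j - rayleigh lam x)^2 * (x$j)^2"
    unfolding residual_sq_def using supp
    by (intro sum_UNIV_two_support[OF \<open>i \<noteq> j\<close>]) simp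
  also have "\<dots> = (x$i * x$j * (lam j - lam i))^2"
    using sum_sq unfolding rayleigh by algebra
  finally show "residual_sq lam x = (x$i * x$j * (lam j - lam i))^2" .
qed

lemma residual_step_two_support:
  fixes x :: "real^'n::finite" and lam :: "'n \<Rightarrow> real"
  assumes unit: "norm x = 1" and "i \<noteq> j" and supp: "\<forall>k. k \<noteq> i \<longrightarrow> k \<noteq> j \<longrightarrow> x$k = 0"
  defines "p \<equiv> x$i * x$j * (lam j - lam i)"
  shows "residual_step lam x $ i = - sgn p * x$j"
    and "residual_step lam x $ j = sgn p * x$i"
    and "\<forall>k. k \<noteq> i \<longrightarrow> k \<noteq> j \<longrightarrow> residual_step lam x $ k = 0"
proof -
  have sqrt_res: "sqrt (residual_sq lam x) = \<bar>p\<bar>"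
    using two_support_unit(3)[OF assms(1-3)] by (simp add: p_def)
  have sum_sq: "(x$i)^2 + (x$j)^2 = 1"
    and rayleigh: "rayleigh lam x = (x$i)^2 * lam i + (x$j)^2 * lam j"
    using two_support_unit(1,2)[OF assms(1-3)] by blast+
  have "lam i - rayleigh lam x = - ((x$j)^2 * (lam j - lam i))"
    unfolding rayleigh using sum_sq by algebra
  moreover have "lam j - rayleigh lam x = (x$i)^2 * (lam j - lam i)"
    unfolding rayleigh using sum_sq by algebra
  ultimately have "residual_step lam x $ i = - x$j * (p / \<bar>p\<bar>)"
    and "residual_step lam x $ j = x$i * (p / \<bar>p\<bar>)"
    unfolding residual_step_nth sqrt_res by (simp_all add: p_def power2_eq_square)
  then show "residual_step lam x $ i = - sgn p * x$j" and "residual_step lam x $ j = sgn p * x$i"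
    by (simp_all add: real_sgn_eq)
  show "\<forall>k. k \<noteq> i \<longrightarrow> k \<noteq> j \<longrightarrow> residual_step lam x $ k = 0"
    using supp by (simp add: residual_step_nth)
qed

lemma residual_step_residual_step_two_sparse:
  fixes x :: "real^'n::finite"
  assumes unit: "norm x = 1" and "two_sparse x" and pos: "residual_sq lam x > 0"
  shows "residual_step lam (residual_step lam x) = x"
proof -
  obtain i j where ij: "i \<noteq> j" and supp: "\<forall>k. k \<noteq> i \<longrightarrow> k \<noteq> j \<longrightarrow> x$k = 0"
    using \<open>two_sparse x\<close> unfolding two_sparse_def by blast
  define p where "p = x$i * x$j * (lam j - lam i)"
  define y where "y = residual_step lam x"
  have "p \<noteq> 0"
    using pos two_support_unit(3)[OF unit ij supp] by (simp add: p_def)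
  then have sgn_sq: "sgn p * sgn p = 1"
    by (simp add: sgn_mult_self_eq)
  have y: "y$i = - sgn p * x$j" "y$j = sgn p * x$i" "\<forall>k. k \<noteq> i \<longrightarrow> k \<noteq> j \<longrightarrow> y$k = 0"
    using residual_step_two_support[OF unit ij supp] by (simp_all add: y_def p_def)
  have "norm y = 1"
    using pos by (simp add: y_def norm_residual_step)
  have "y$i * y$j * (lam j - lam i) = - p"
    using sgn_sq by (simp add: y p_def)
  then have "residual_step lam y $ i = sgn p * sgn p * x$i"
    and "residual_step lam y $ j = sgn p * sgn p * x$j"
    and "\<forall>k. k \<noteq> i \<longrightarrow> k \<noteq> j \<longrightarrow> residual_step lam y $ k = 0"
    using residual_step_two_support[OF \<open>norm y = 1\<close> ij y(3), of lam]
    by (simp_all add: y(1,2) sgn_minus)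
  with supp sgn_sq show ?thesis
    unfolding y_def vec_eq_iff by (metis mult_1)
qed

lemma finite_vec_components:
  assumes "finite R"
  shows "finite {x :: 'a^'n::finite. \<forall>k. x$k \<in> R}"
proof -
  have "{x :: 'a^'n. \<forall>k. x$k \<in> R} \<subseteq> vec_lambda ` (UNIV \<rightarrow>\<^sub>E R)"
    by (auto intro!: image_eqI[where x = "vec_nth _"])
  then show ?thesis
    by (rule finite_subset) (simp add: assms finite_PiE)
qed

lemma finite_biquadratic_roots: "finite {s::real. s^4 - s^2 + c = 0}"
proof -
  have roots: "{s::real. s^4 - s^2 + c = 0} = {s. poly [:c, 0, -1, 0, 1:] s = 0}"
    by (auto simp: algebra_simps power2_eq_square power4_eq_xxxx)
  show ?thesis
    unfolding roots by (rule poly_roots_finite) simp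
qed

lemma finite_two_sparse_level_set:
  assumes "inj lam"
  shows "finite {x :: real^'n::finite. norm x = 1 \<and> two_sparse x \<and> residual_sq lam x = L}"
proof -
  define R where "R = insert 0 (\<Union>i. \<Union>j. {s::real. s^4 - s^2 + L / (lam j - lam i)^2 = 0})"
  have "finite R"
    by (simp add: R_def finite_biquadratic_roots)
  have "x$k \<in> R" if "norm x = 1" "two_sparse x" "residual_sq lam x = L" for x :: "real^'n" and k
  proof -
    obtain i j where ij: "i \<noteq> j" and supp: "\<forall>k. k \<noteq> i \<longrightarrow> k \<noteq> j \<longrightarrow> x$k = 0"
      using \<open>two_sparse x\<close> unfolding two_sparse_def by blast
    have "lam j - lam i \<noteq> 0"
      using \<open>inj lam\<close> ij by (auto dest: injD)
    moreover have "L = (x$i)^2 * (x$j)^2 * (lam j - lam i)^2"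
      using two_support_unit(3)[OF \<open>norm x = 1\<close> ij supp, of lam] \<open>residual_sq lam x = L\<close>
      by (simp only: power_mult_distrib)
    ultimately have prod: "(x$i)^2 * (x$j)^2 = L / (lam j - lam i)^2"
      by simp
    have sum_sq: "(x$i)^2 + (x$j)^2 = 1"
      using two_support_unit(1)[OF \<open>norm x = 1\<close> ij supp] .
    have "(x$i)^4 - (x$i)^2 + L / (lam j - lam i)^2 = (x$i)^2 * ((x$i)^2 + (x$j)^2 - 1)"
      and "(x$j)^4 - (x$j)^2 + L / (lam j - lam i)^2 = (x$j)^2 * ((x$i)^2 + (x$j)^2 - 1)"
      unfolding prod[symmetric] by (simp_all add: power2_eq_square power4_eq_xxxx algebra_simps)
    then have "(x$i)^4 - (x$i)^2 + L / (lam j - lam i)^2 = 0"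
      and "(x$j)^4 - (x$j)^2 + L / (lam j - lam i)^2 = 0"
      using sum_sq by simp_all
    then show ?thesis
      using supp by (cases "k = i \<or> k = j") (auto simp: R_def)
  qed
  then have "{x :: real^'n. norm x = 1 \<and> two_sparse x \<and> residual_sq lam x = L} \<subseteq> {x. \<forall>k. x$k \<in> R}"
    by blast
  then show ?thesis
    by (rule finite_subset) (rule finite_vec_components[OF \<open>finite R\<close>])
qed

lemma isCont_residual_sq: "isCont (residual_sq lam) x"
  unfolding residual_sq_def rayleigh_def
  by (intro continuous_intros isCont_vec_nth continuous_ident)

lemma isCont_residual_step:
  assumes "residual_sq lam x > 0"
  shows "isCont (residual_step lam) x"
proof -
  have "norm (residual lam x) \<noteq> 0"
    using assms by (simp add: norm_residual)
  then show ?thesis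
    unfolding continuous_at residual_step_def residual_def rayleigh_def
    by (intro tendsto_intros tendsto_vec_nth tendsto_ident_at) (simp add: residual_def rayleigh_def)
qed

lemma residual_sq_le_sum_sq:
  assumes "norm (x::real^'n::finite) = 1"
  shows "residual_sq lam x \<le> (\<Sum>i\<in>UNIV. (lam i)^2)"
proof -
  have "(x$i)^2 \<le> 1" for i
    using member_le_sum[of i UNIV "\<lambda>i. (x$i)^2"] assms by (simp add: norm_eq_1_iff_sum_sq)
  then have "(\<Sum>i\<in>UNIV. (lam i - 0)^2 * (x$i)^2) \<le> (\<Sum>i\<in>UNIV. (lam i)^2)"
    by (intro sum_mono) (simp add: mult_left_le)
  moreover have "(rayleigh lam x - 0)^2 \<ge> 0"
    by simp
  ultimately show ?thesis
    using sum_sq_deviation[OF assms, of lam 0] by linarith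
qed

lemma residual_iteration_unit_mono:
  assumes "norm (x 0) = 1" and "residual_sq lam (x 0) > 0"
    and step: "\<And>k. x (Suc k) = residual_step lam (x k)"
  shows "norm (x k) = 1 \<and> residual_sq lam (x 0) \<le> residual_sq lam (x k)"
proof (induction k)
  case 0
  show ?case using assms(1) by simp
next
  case (Suc k)
  then have "residual_sq lam (x k) > 0"
    using assms(2) by linarith
  then show ?case
    using Suc residual_sq_le_residual_sq_step[of "x k" lam]
    by (auto simp: step norm_residual_step)
qed

lemma limit_point_residual_iteration:
  assumes "inj lam" and step: "\<And>k. x (Suc k) = residual_step lam (x k)"
    and unit: "\<And>k. norm (x k) = 1"
    and res_lim: "(\<lambda>k. residual_sq lam (x k)) \<longlonglongrightarrow> L" and "L > 0"
    and r: "strict_mono r" and lim: "(x \<circ> r) \<longlonglongrightarrow> g"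
  shows "norm g = 1 \<and> two_sparse g \<and> residual_sq lam g = L"
proof -
  have lim': "(\<lambda>n. x (r n)) \<longlonglongrightarrow> g"
    using lim by (simp add: o_def)
  have "(\<lambda>n. norm (x (r n))) \<longlonglongrightarrow> norm g"
    using lim' by (rule tendsto_norm)
  then have "norm g = 1"
    by (simp add: unit LIMSEQ_const_iff)
  have "(\<lambda>n. residual_sq lam (x (r n))) \<longlonglongrightarrow> residual_sq lam g"
    using isCont_tendsto_compose[OF isCont_residual_sq lim'] .
  moreover have "(\<lambda>n. residual_sq lam (x (r n))) \<longlonglongrightarrow> L"
    using LIMSEQ_subseq_LIMSEQ[OF res_lim r] by (simp add: o_def)
  ultimately have "residual_sq lam g = L"
    by (rule LIMSEQ_unique)
  then have pos: "residual_sq lam g > 0"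
    using \<open>L > 0\<close> by simp
  have "(\<lambda>n. x (Suc (r n))) \<longlonglongrightarrow> residual_step lam g"
    unfolding step using isCont_tendsto_compose[OF isCont_residual_step[OF pos] lim'] .
  then have "(\<lambda>n. residual_sq lam (x (Suc (r n)))) \<longlonglongrightarrow> residual_sq lam (residual_step lam g)"
    by (rule isCont_tendsto_compose[OF isCont_residual_sq])
  moreover have "strict_mono (\<lambda>n. Suc (r n))"
    using r by (simp add: strict_mono_def)
  then have "(\<lambda>n. residual_sq lam (x (Suc (r n)))) \<longlonglongrightarrow> L"
    using LIMSEQ_subseq_LIMSEQ[OF res_lim] by (simp add: o_def)
  ultimately have "residual_sq lam (residual_step lam g) = residual_sq lam g"
    using \<open>residual_sq lam g = L\<close> LIMSEQ_unique by blast
  then have "two_sparse g"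
    using two_sparse_if_residual_sq_step_eq[OF \<open>norm g = 1\<close> pos \<open>inj lam\<close>] by blast
  with \<open>norm g = 1\<close> \<open>residual_sq lam g = L\<close> show ?thesis
    by blast
qed

section \<open>Convergence of the even iterates\<close>

theorem convergent_even_residual_iteration:
  assumes "inj lam" and "norm (x 0) = 1" and "residual_sq lam (x 0) > 0"
    and step: "\<And>k. x (Suc k) = residual_step lam (x k)"
  shows "convergent (\<lambda>k. x (2 * k))"
proof -
  have unit: "norm (x k) = 1" and ge0: "residual_sq lam (x 0) \<le> residual_sq lam (x k)" for k
    using residual_iteration_unit_mono[OF assms(2-4)] by simp_all
  have pos: "residual_sq lam (x k) > 0" for k
    using assms(3) ge0 by (rule less_le_trans)
  have "incseq (\<lambda>k. residual_sq lam (x k))"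
    using residual_sq_le_residual_sq_step[OF unit pos] by (intro incseq_SucI) (simp add: step)
  moreover have "\<forall>k. residual_sq lam (x k) \<le> (\<Sum>i\<in>UNIV. (lam i)^2)"
    using residual_sq_le_sum_sq[OF unit] by blast
  ultimately obtain L where res_lim: "(\<lambda>k. residual_sq lam (x k)) \<longlonglongrightarrow> L"
    and le_L: "\<forall>k. residual_sq lam (x k) \<le> L"
    by (rule incseq_convergent)
  have "L > 0"
    using assms(3) le_L by (meson less_le_trans)
  define u where "u = (\<lambda>k. x (2 * k))"
  define \<Lambda> where "\<Lambda> = {g. norm g = 1 \<and> two_sparse g \<and> residual_sq lam g = L}"
  have limit_points: "g \<in> \<Lambda>" if "strict_mono r" "(u \<circ> r) \<longlonglongrightarrow> g" for r g
  proof -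
    have "strict_mono (\<lambda>n. 2 * r n)"
      using that(1) by (simp add: strict_mono_def)
    then show ?thesis
      using limit_point_residual_iteration[OF \<open>inj lam\<close> step unit res_lim \<open>L > 0\<close>] that(2)
      by (simp add: \<Lambda>_def u_def o_def)
  qed
  define F where "F = residual_step lam \<circ> residual_step lam"
  have fixed: "F g = g \<and> isCont F g" if "g \<in> \<Lambda>" for g
  proof -
    have pos: "residual_sq lam g > 0" and "norm g = 1" "two_sparse g"
      using that \<open>L > 0\<close> by (auto simp: \<Lambda>_def)
    then have "F g = g"
      by (simp add: F_def residual_step_residual_step_two_sparse)
    moreover have "residual_sq lam (residual_step lam g) > 0"
      using residual_sq_le_residual_sq_step[OF \<open>norm g = 1\<close> pos] pos by linarith
    then have "isCont F g"
      unfolding F_def using pos by (intro continuous_at_compose isCont_residual_step)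
    ultimately show ?thesis ..
  qed
  have "bounded (range u)"
    by (auto simp: bounded_iff u_def unit)
  moreover have "u (Suc k) = F (u k)" for k
    by (simp add: u_def F_def step)
  ultimately have "(\<lambda>k. dist (u (Suc k)) (u k)) \<longlonglongrightarrow> 0"
    by (rule dist_Suc_tendsto_0_if_limit_points_fixed) (use fixed limit_points in blast)
  moreover have "finite \<Lambda>"
    unfolding \<Lambda>_def using \<open>inj lam\<close> by (rule finite_two_sparse_level_set)
  ultimately have "convergent u"
    using \<open>bounded (range u)\<close> limit_points by (intro convergent_if_dist_Suc_tendsto_0_finite_limit_points)
  then show ?thesis
    by (simp add: u_def)
qed

lemma diag_mult_vec: "(\<chi> i j. if i = j then lam i else 0) *v x = (\<chi> i. lam i * x$i)"
  by (simp add: matrix_vector_mult_def vec_eq_iff if_distrib[where f = "\<lambda>a. a * _"] cong: if_cong)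

lemma diag_residual:
  assumes "A = (\<chi> i j. if i = j then lam i else 0)"
  shows "A *v x - (x \<bullet> (A *v x)) *\<^sub>R x = residual lam x"
proof -
  have "x \<bullet> (A *v x) = rayleigh lam x"
    by (simp add: assms diag_mult_vec inner_vec_def rayleigh_def power2_eq_square algebra_simps)
  then show ?thesis
    by (simp add: assms diag_mult_vec residual_def vec_eq_iff algebra_simps)
qed

lemma residual_sq_pos_if_grade_ge_2:
  assumes "A = (\<chi> i j. if i = j then lam i else 0)" and "grade A x \<ge> 2"
  shows "residual_sq lam x > 0"
proof (rule ccontr)
  assume "\<not> residual_sq lam x > 0"
  then have "norm (residual lam x) = 0"
    using residual_sq_nonneg[of lam x] by (simp add: norm_residual)
  then have "residual lam x = 0"
    by simp
  then have "\<exists>c. ((*v) A ^^ 1) x + (\<Sum>i<1. c i *\<^sub>R ((*v) A ^^ i) x) = 0"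
    using diag_residual[OF assms(1), of x] by (intro exI[of _ "\<lambda>_. - (x \<bullet> (A *v x))"]) simp
  then have "grade A x \<le> 1"
    unfolding grade_def by (rule Least_le)
  with assms(2) show False
    by simp
qed

theorem theorem4p3:
  fixes lam :: "'n::{finite,linorder} \<Rightarrow> real"
    and A :: "real^'n::{finite,linorder}^'n::{finite,linorder}"
    and v :: "nat \<Rightarrow> real^'n::{finite,linorder}"
  assumes A_def: "A = (\<chi> i j. if i = j then lam i else 0)"
    and incr: "strict_mono lam"
    and unit: "norm (v 0) = 1"
    and grade: "grade A (v 0) \<ge> 2"
    and iter: "\<And>k. v (Suc k) =
       (let \<rho> = v k \<bullet> (A *v v k);
            w = A *v v k - \<rho> *\<^sub>R v k
        in w /\<^sub>R norm w)"
  shows "convergent (\<lambda>k. v (2 * k))"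
proof (rule convergent_even_residual_iteration)
  show "inj lam"
    using incr by (rule strict_mono_imp_inj_on)
  show "norm (v 0) = 1"
    by (fact unit)
  show "residual_sq lam (v 0) > 0"
    using A_def grade by (rule residual_sq_pos_if_grade_ge_2)
  show "v (Suc k) = residual_step lam (v k)" for k
    using iter[of k] by (simp add: Let_def diag_residual[OF A_def] residual_step_def)
qed

end
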